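(* Let $G$ be a graph on $n$ vertices. If $i \ge \frac{n+\Gamma(G)-1}{2}$, then $d_i(G) \ge d_{i+1}(G)$.
   Context: $G$ is a finite simple graph. A set $U\subseteq V(G)$ is dominating if every vertex is in $U$ or adjacent to a vertex of $U$; $d_i(G)$ denotes the number of dominating sets of $G$ of size $i$ (so $d_i(G)=0$ for $i>n$). A dominating set is minimal if no proper subset of it is dominating. The upper domination number $\Gamma(G)$ is the maximum size of a minimal dominating set of $G$. *)

theory Defs
  imports Complex_Main "Graph_Theory.Graph_Theory"
begin

text \<open>
  A finite simple graph is a structure satisfying the locale predicate \<^const>\<open>graph\<close>: a finite,
  symmetric digraph without loops and parallel arcs, in which an edge is represented by its two
  orientations. The null graph is allowed. Adjacency of \<open>u\<close> and \<open>v\<close> is \<open>u \<rightarrow>\<^bsub>G\<^esub> v\<close>.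
\<close>

definition dominating_set :: "('a, 'b) pre_digraph \<Rightarrow> 'a set \<Rightarrow> bool" where
  "dominating_set G U \<longleftrightarrow>
     U \<subseteq> verts G \<and> (\<forall>v \<in> verts G. v \<in> U \<or> (\<exists>u \<in> U. v \<rightarrow>\<^bsub>G\<^esub> u))"

definition num_dominating_sets :: "('a, 'b) pre_digraph \<Rightarrow> nat \<Rightarrow> nat" where
  "num_dominating_sets G i = card {U. dominating_set G U \<and> card U = i}"

definition minimal_dominating_set :: "('a, 'b) pre_digraph \<Rightarrow> 'a set \<Rightarrow> bool" where
  "minimal_dominating_set G U \<longleftrightarrow>
     dominating_set G U \<and> (\<forall>W. W \<subset> U \<longrightarrow> \<not> dominating_set G W)"

definition upper_domination_number :: "('a, 'b) pre_digraph \<Rightarrow> nat" where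
  "upper_domination_number G = Max (card ` {U. minimal_dominating_set G U})"

text \<open>The maximum is taken over a finite nonempty set:\<close>

lemma (in graph) finite_minimal_dominating_sets: "finite {U. minimal_dominating_set G U}"
  by (rule finite_subset[of _ "Pow (verts G)"])
    (auto simp: minimal_dominating_set_def dominating_set_def)

lemma (in graph) minimal_dominating_set_exists: "{U. minimal_dominating_set G U} \<noteq> {}"
proof -
  let ?S = "{U. dominating_set G U}"
  have "finite ?S"
    by (rule finite_subset[of _ "Pow (verts G)"]) (auto simp: dominating_set_def)
  moreover have "?S \<noteq> {}"
    by (auto simp: dominating_set_def)
  ultimately obtain U where "U \<in> ?S" "\<forall>W \<in> ?S. W \<subseteq> U \<longrightarrow> U = W"
    using finite_has_minimal[of ?S] by blast
  then have "minimal_dominating_set G U"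
    by (auto simp: minimal_dominating_set_def)
  then show ?thesis by blast
qed

end

theory Submission
  imports Defs
begin

text \<open>
  Count the pairs of dominating sets \<open>T \<subseteq> S\<close> with \<open>|T| = i\<close> and \<open>|S| = i + 1\<close>. A vertex \<open>v \<in> S\<close>
  such that \<open>S - {v}\<close> is not dominating lies in every dominating subset of \<open>S\<close>, in particular in a
  minimal one, so there are at most \<open>\<Gamma>\<close> such vertices and \<open>S\<close> occurs in at least \<open>i + 1 - \<Gamma>\<close> pairs.
  Each \<open>T\<close> occurs in at most \<open>n - i\<close> pairs, and \<open>n - i \<le> i + 1 - \<Gamma>\<close> is the hypothesis.
\<close>

lemma dominating_set_mono:
  assumes "dominating_set G T" "T \<subseteq> S" "S \<subseteq> verts G"
  shows "dominating_set G S"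
  using assms unfolding dominating_set_def by blast

context graph
begin

lemma finite_dominating_sets: "finite {U. dominating_set G U \<and> P U}"
  by (rule finite_subset[of _ "Pow (verts G)"]) (auto simp: dominating_set_def)

lemma minimal_dominating_subset_exists:
  assumes "dominating_set G S"
  obtains M where "minimal_dominating_set G M" "M \<subseteq> S"
proof -
  let ?A = "{U. dominating_set G U \<and> U \<subseteq> S}"
  have "?A \<noteq> {}"
    using assms by blast
  then obtain M where "M \<in> ?A" "\<forall>W \<in> ?A. W \<subseteq> M \<longrightarrow> M = W"
    using finite_has_minimal[of ?A] finite_dominating_sets[of "\<lambda>U. U \<subseteq> S"] by blast
  \<comment> \<open>Minimality within \<open>?A\<close> is minimality in \<open>G\<close>, since
    every subset of \<open>M\<close> is also a subset of \<open>S\<close>.\<close>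
  then have "minimal_dominating_set G M" "M \<subseteq> S"
    by (auto simp: minimal_dominating_set_def)
  then show thesis by (rule that)
qed

lemma card_critical_vertices_le:
  assumes "dominating_set G S"
  shows "card {v \<in> S. \<not> dominating_set G (S - {v})} \<le> upper_domination_number G"
proof -
  obtain M where M: "minimal_dominating_set G M" "M \<subseteq> S"
    using minimal_dominating_subset_exists[OF assms] .
  have sub: "S \<subseteq> verts G"
    using assms by (simp add: dominating_set_def)
  have "{v \<in> S. \<not> dominating_set G (S - {v})} \<subseteq> M"
  proof safe
    fix v assume "\<not> dominating_set G (S - {v})"
    \<comment> \<open>If \<open>M\<close> avoids \<open>v\<close>, then \<open>M\<close> lies in
      \<open>S - {v}\<close>, which inherits domination from it.\<close>
    moreover have "dominating_set G (S - {v})" if "v \<notin> M"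
    proof (rule dominating_set_mono)
      show "dominating_set G M"
        using M by (simp add: minimal_dominating_set_def)
    qed (use M sub that in blast)+
    ultimately show "v \<in> M" by blast
  qed
  then have "card {v \<in> S. \<not> dominating_set G (S - {v})} \<le> card M"
    using M sub finite_verts by (meson card_mono finite_subset)
  also have "\<dots> \<le> upper_domination_number G"
    unfolding upper_domination_number_def
    using M finite_minimal_dominating_sets by (intro Max_ge) auto
  finally show ?thesis .
qed

lemma card_dominating_subsets_ge:
  assumes "dominating_set G S" "card S = Suc i"
  shows "Suc i \<le> card {T. (dominating_set G T \<and> card T = i) \<and> T \<subseteq> S} + upper_domination_number G"
proof -
  let ?C = "{v \<in> S. \<not> dominating_set G (S - {v})}"
  have fin: "finite S"
    using assms(2) by (simp add: card_ge_0_finite)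
  \<comment> \<open>Deleting different noncritical vertices gives different dominating sets of size
    \<open>i\<close>.\<close>
  have "card (S - ?C) = card ((\<lambda>v. S - {v}) ` (S - ?C))"
    by (rule card_image[symmetric]) (auto simp: inj_on_def)
  also have "\<dots> \<le> card {T. (dominating_set G T \<and> card T = i) \<and> T \<subseteq> S}"
    using fin assms(2) by (intro card_mono) auto
  finally show ?thesis
    using card_critical_vertices_le[OF assms(1)] assms(2) fin card_Diff_subset[of ?C S]
    by simp
qed

text \<open>Each such \<open>S\<close> is \<open>T\<close> plus one vertex outside \<open>T\<close>,
  so it is determined by that vertex.\<close>

lemma card_dominating_supersets_le:
  assumes "dominating_set G T" "card T = i"
  shows "card {S. (dominating_set G S \<and> card S = Suc i) \<and> T \<subseteq> S} \<le> card (verts G) - i"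
proof -
  have T: "T \<subseteq> verts G" "finite T"
    using assms(1) finite_verts by (auto simp: dominating_set_def intro: finite_subset)
  have "{S. (dominating_set G S \<and> card S = Suc i) \<and> T \<subseteq> S} \<subseteq> (\<lambda>v. insert v T) ` (verts G - T)"
  proof safe
    fix S assume S: "dominating_set G S" "card S = Suc i" "T \<subseteq> S"
    then have "card (S - T) = 1"
      using T assms(2) by (simp add: card_Diff_subset)
    then obtain v where "S - T = {v}"
      by (rule card_1_singletonE)
    then show "S \<in> (\<lambda>v. insert v T) ` (verts G - T)"
      using S by (intro image_eqI[of _ _ v]) (auto simp: dominating_set_def)
  qed
  then have "card {S. (dominating_set G S \<and> card S = Suc i) \<and> T \<subseteq> S} \<le> card (verts G - T)"
    using finite_verts by (intro surj_card_le) auto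
  then show ?thesis
    using T assms(2) by (simp add: card_Diff_subset)
qed

text \<open>Both sides bound the number of pairs \<open>T\<close> \<subseteq> \<open>S\<close>,
  counted by \<open>S\<close> on the left and by \<open>T\<close> on the right. If
  \<open>Suc i\<close> is below the upper domination number, truncated subtraction makes the left
  side 0.\<close>

lemma num_dominating_sets_Suc_le:
  "num_dominating_sets G (Suc i) * (Suc i - upper_domination_number G)
     \<le> num_dominating_sets G i * (card (verts G) - i)"
proof -
  let ?D = "\<lambda>k. {U. dominating_set G U \<and> card U = k}"
  have "num_dominating_sets G (Suc i) * (Suc i - upper_domination_number G)
      \<le> (\<Sum>S \<in> ?D (Suc i). card {T \<in> ?D i. T \<subseteq> S})"
    unfolding num_dominating_sets_def
    using card_dominating_subsets_ge[of _ i]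
    by (intro sum_bounded_below[where 'a = nat, simplified]) fastforce
  also have "\<dots> = (\<Sum>T \<in> ?D i. card {S \<in> ?D (Suc i). T \<subseteq> S})"
    by (rule sum_multicount_gen) (auto simp: finite_dominating_sets)
  also have "\<dots> \<le> num_dominating_sets G i * (card (verts G) - i)"
    unfolding num_dominating_sets_def
    using card_dominating_supersets_le[of _ i]
    by (intro sum_bounded_above[where 'a = nat, simplified]) simp
  finally show ?thesis .
qed

text \<open>Covers \<open>i\<close> \<ge> \<open>n\<close> in the theorem, where the factor
  \<open>n - i\<close> is 0 and cannot be cancelled.\<close>

lemma num_dominating_sets_eq_0:
  assumes "card (verts G) < i"
  shows "num_dominating_sets G i = 0"
proof -
  have "card U \<le> card (verts G)" if "dominating_set G U" for U
    using that finite_verts by (auto simp: dominating_set_def intro: card_mono)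
  then have "{U. dominating_set G U \<and> card U = i} = {}"
    using assms by fastforce
  then show ?thesis
    unfolding num_dominating_sets_def by (simp only: card.empty)
qed

end

theorem theorem6p2:
  fixes G :: "('a, 'b) pre_digraph" and n i :: nat
  assumes "graph G"
    and "card (verts G) = n"
    and "real i \<ge> (real n + real (upper_domination_number G) - 1) / 2"
  shows "num_dominating_sets G i \<ge> num_dominating_sets G (i + 1)"
proof (cases "i < n")
  case True
  interpret graph G by fact
  let ?g = "upper_domination_number G"
  have "real (n + ?g) \<le> real (2 * i + 1)"
    using assms(3) by simp
  then have "n + ?g \<le> 2 * i + 1"
    by (simp only: of_nat_le_iff)
  \<comment> \<open>As \<open>i < n\<close>, the bound forces \<open>?g\<close> \<le>
    \<open>i\<close>, so neither subtraction is truncated.\<close>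
  then have "n - i \<le> Suc i - ?g"
    by linarith
  then have "num_dominating_sets G (Suc i) * (n - i) \<le> num_dominating_sets G (Suc i) * (Suc i - ?g)"
    by (rule mult_le_mono2)
  also have "\<dots> \<le> num_dominating_sets G i * (n - i)"
    using num_dominating_sets_Suc_le assms(2) by simp
  \<comment> \<open>The common factor \<open>n - i\<close> is positive and cancels.\<close>
  finally show ?thesis
    using True by simp
next
  case False
  then show ?thesis
    using graph.num_dominating_sets_eq_0[OF assms(1), of "i + 1"] assms(2) by simp
qed

end
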